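(* Let $\alpha,\beta,r,\sigma,\mathcal A$ be real constants with $\alpha\neq 0$, $\sigma\neq0$, $\mathcal A\neq0$, $|\mathcal A|\neq 1$, and let $f(\zeta)=\alpha(\zeta-\beta)^2$. Then the function $$u(x,t)=\beta-\frac{12\sigma^2}{\alpha\left(t(\sigma^2-2r)+2\log|x|\right)^2}$$ is a solution, at all points $(x,t)$ with $x\neq0$ at which the denominator does not vanish, of the equation $$u_t+\tfrac12\sigma^2x^2u_{xx}+r x u_x+f(u)=0,$$ and it satisfies the barrier condition $u(H(t),t)=R(t)$ for all $t$, where $$H(t)=\mathcal A e^{\frac12(2r-\sigma^2)t},\qquad R(t)=\beta-\frac{3\sigma^2}{\alpha\log^2|\mathcal A|}.$$
   Context: $u=u(x,t)$ is a real-valued function; subscripts denote partial derivatives; $\log$ is the natural logarithm and $\log^2|\mathcal A|=(\log|\mathcal A|)^2$. $H$ is the barrier function and $R$ the rebate function of a (down-and-out) barrier option, and the barrier condition is $u(H(t),t)=R(t)$. *)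

theory Defs
  imports "HOL-Analysis.Analysis"
begin

definition D_t :: "(real \<Rightarrow> real \<Rightarrow> real) \<Rightarrow> real \<Rightarrow> real \<Rightarrow> real"
  where "D_t u x t = deriv (\<lambda>s. u x s) t"

definition D_x :: "(real \<Rightarrow> real \<Rightarrow> real) \<Rightarrow> real \<Rightarrow> real \<Rightarrow> real"
  where "D_x u x t = deriv (\<lambda>y. u y t) x"

text \<open>
  Since \<^const>\<open>deriv\<close> is total, existence of the derivatives \<open>u\<^sub>t\<close>, \<open>u\<^sub>x\<close>, \<open>u\<^sub>x\<^sub>x\<close> is required
  explicitly. For \<open>u\<^sub>x\<^sub>x\<close> to make sense at \<open>x\<close>, \<open>u\<^sub>x\<close> must exist in a neighbourhood of \<open>x\<close>.
\<close>

definition solves_BS_at ::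
  "real \<Rightarrow> real \<Rightarrow> (real \<Rightarrow> real) \<Rightarrow> (real \<Rightarrow> real \<Rightarrow> real) \<Rightarrow> real \<Rightarrow> real \<Rightarrow> bool"
  where "solves_BS_at r \<sigma> f u x t \<longleftrightarrow>
    (\<lambda>s. u x s) field_differentiable (at t) \<and>
    (\<forall>\<^sub>F y in nhds x. (\<lambda>z. u z t) field_differentiable (at y)) \<and>
    (\<lambda>y. D_x u y t) field_differentiable (at x) \<and>
    D_t u x t + 1/2 * \<sigma>\<^sup>2 * x\<^sup>2 * D_x (D_x u) x t + r * x * D_x u x t + f (u x t) = 0"

definition solves_BS_on ::
  "(real \<times> real) set \<Rightarrow> real \<Rightarrow> real \<Rightarrow> (real \<Rightarrow> real) \<Rightarrow> (real \<Rightarrow> real \<Rightarrow> real) \<Rightarrow> bool"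
  where "solves_BS_on \<Omega> r \<sigma> f u \<longleftrightarrow> (\<forall>(x, t) \<in> \<Omega>. solves_BS_at r \<sigma> f u x t)"

text \<open>
  The set \<open>\<Omega>\<close> is the domain of definition of \<open>u\<close>; the value \<open>u (H t) t\<close> is meaningful only if
  \<open>(H t, t)\<close> lies in it.
\<close>

definition barrier_condition ::
  "(real \<times> real) set \<Rightarrow> (real \<Rightarrow> real \<Rightarrow> real) \<Rightarrow> (real \<Rightarrow> real) \<Rightarrow> (real \<Rightarrow> real) \<Rightarrow> bool"
  where "barrier_condition \<Omega> u H R \<longleftrightarrow> (\<forall>t. (H t, t) \<in> \<Omega> \<and> u (H t) t = R t)"

end

theory Submission imports Defs begin

text \<open>
  The solution is a travelling wave in the logarithmic variable
  \<open>L = t * (\<sigma>\<^sup>2 - 2 * r) + 2 * ln \<bar>x\<bar>\<close>. For a profile \<open>w\<close> and \<open>u x t = w L\<close> the chain rule gives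
  \<open>u\<^sub>t = (\<sigma>\<^sup>2 - 2 * r) * w'\<close>, \<open>x * u\<^sub>x = 2 * w'\<close> and \<open>x\<^sup>2 * u\<^sub>x\<^sub>x = 4 * w'' - 2 * w'\<close>. The speed
  \<open>\<sigma>\<^sup>2 - 2 * r\<close> is exactly the one for which all first-order terms cancel, so the equation collapses
  to the ordinary differential equation \<open>2 * \<sigma>\<^sup>2 * w'' + f w = 0\<close>
  (lemma \<open>solves_BS_at_travelling_wave\<close>). For \<open>f w = \<alpha> * (w - \<beta>)\<^sup>2\<close> a profile \<open>w = \<beta> - C / L\<^sup>2\<close> turns
  both terms into multiples of \<open>1 / L ^ 4\<close>, and they balance precisely for \<open>C = 12 * \<sigma>\<^sup>2 / \<alpha>\<close>.

  The barrier \<open>H\<close> is a level curve of the wave variable: along it \<open>L = 2 * ln \<bar>\<A>\<bar>\<close>, so \<open>u\<close> is constant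
  there. The condition \<open>\<bar>\<A>\<bar> \<noteq> 1\<close> keeps this level away from the singularity \<open>L = 0\<close>.
\<close>

lemma has_real_derivative_ln_abs:
  fixes x :: real
  assumes "x \<noteq> 0"
  shows "((\<lambda>y. ln \<bar>y\<bar>) has_real_derivative 1 / x) (at x)"
proof (cases "x > 0")
  case True
  then show ?thesis
    by (intro has_field_derivative_transform_within_open[OF DERIV_ln_divide open_greaterThan]) auto
next
  case False
  with assms have "((\<lambda>y. ln (- y)) has_real_derivative 1 / x) (at x)"
    by (auto intro!: derivative_eq_intros)
  then show ?thesis
    by (rule has_field_derivative_transform_within_open[OF _ open_lessThan[of 0]])
      (use False assms in auto)
qed

text \<open>
  The pointwise reduction of the partial differential equation to its travelling-wave equation.
  The first derivative of the profile is needed on a neighbourhood, because \<open>u\<^sub>x\<^sub>x\<close> differentiates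
  \<open>u\<^sub>x\<close>; continuity of the wave variable pulls that neighbourhood back to one of \<open>x\<close>.
\<close>

lemma solves_BS_at_travelling_wave:
  fixes w w' f :: "real \<Rightarrow> real" and r \<sigma> x t w2 :: real
  defines "L \<equiv> \<lambda>y s. s * (\<sigma>\<^sup>2 - 2 * r) + 2 * ln \<bar>y\<bar>"
  assumes x: "x \<noteq> 0"
    and w': "\<forall>\<^sub>F z in nhds (L x t). (w has_real_derivative w' z) (at z)"
    and w2: "(w' has_real_derivative w2) (at (L x t))"
    and ode: "2 * \<sigma>\<^sup>2 * w2 + f (w (L x t)) = 0"
  shows "solves_BS_at r \<sigma> f (\<lambda>y s. w (L y s)) x t"
proof -
  let ?u = "\<lambda>y s. w (L y s)"
  have Lx: "((\<lambda>y. L y t) has_real_derivative 2 / y) (at y)" if "y \<noteq> 0" for y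
    unfolding L_def
    by (rule derivative_eq_intros has_real_derivative_ln_abs that refl | simp)+
  have Lt: "((\<lambda>s. L x s) has_real_derivative \<sigma>\<^sup>2 - 2 * r) (at t)"
    unfolding L_def by (auto intro!: derivative_eq_intros)

  have ut: "((\<lambda>s. ?u x s) has_real_derivative w' (L x t) * (\<sigma>\<^sup>2 - 2 * r)) (at t)"
    by (rule DERIV_chain2[OF eventually_nhds_x_imp_x[OF w'] Lt])

  have "((\<lambda>y. L y t) \<longlongrightarrow> L x t) (nhds x)"
    using DERIV_isCont[OF Lx[OF x]] by (simp add: isCont_def tendsto_at_iff_tendsto_nhds[of "\<lambda>y. L y t"])
  then have "\<forall>\<^sub>F y in nhds x. (w has_real_derivative w' (L y t)) (at (L y t))"
    by (rule eventually_compose_filterlim[OF w'])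
  moreover have "\<forall>\<^sub>F y in nhds x. y \<noteq> 0"
    using x by (rule t1_space_nhds)
  ultimately have ux: "\<forall>\<^sub>F y in nhds x.
      ((\<lambda>z. ?u z t) has_real_derivative w' (L y t) * (2 / y)) (at y)"
    by eventually_elim (rule DERIV_chain2[OF _ Lx])
  then have Dx_eq: "\<forall>\<^sub>F y in nhds x. D_x ?u y t = w' (L y t) * (2 / y)"
    by eventually_elim (simp add: D_x_def DERIV_imp_deriv)

  have "((\<lambda>y. w' (L y t) * (2 / y)) has_real_derivative
      (w2 * (2 / x)) * (2 / x) + w' (L x t) * (- 2 / x\<^sup>2)) (at x)"
    using x by (auto intro!: derivative_eq_intros DERIV_chain2[OF w2 Lx] simp: power2_eq_square diff_divide_distrib)
  then have uxx: "((\<lambda>y. D_x ?u y t) has_real_derivative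
      (w2 * (2 / x)) * (2 / x) + w' (L x t) * (- 2 / x\<^sup>2)) (at x)"
    by (subst DERIV_cong_ev[OF refl Dx_eq refl])

  have "D_t ?u x t = w' (L x t) * (\<sigma>\<^sup>2 - 2 * r)"
    using ut by (simp add: D_t_def DERIV_imp_deriv)
  moreover have "x * D_x ?u x t = 2 * w' (L x t)"
    using eventually_nhds_x_imp_x[OF Dx_eq] x by simp
  moreover have "x\<^sup>2 * D_x (D_x ?u) x t = 4 * w2 - 2 * w' (L x t)"
    unfolding D_x_def[of "D_x ?u"] DERIV_imp_deriv[OF uxx]
    using x by (simp add: field_simps power2_eq_square)
  ultimately have "D_t ?u x t + 1/2 * \<sigma>\<^sup>2 * (x\<^sup>2 * D_x (D_x ?u) x t) + r * (x * D_x ?u x t)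
      + f (?u x t) = 2 * \<sigma>\<^sup>2 * w2 + f (?u x t)"
    by (simp only:) (simp add: algebra_simps)
  then have "D_t ?u x t + 1/2 * \<sigma>\<^sup>2 * x\<^sup>2 * D_x (D_x ?u) x t + r * x * D_x ?u x t
      + f (?u x t) = 0"
    using ode by (simp add: mult.assoc)
  moreover have "\<forall>\<^sub>F y in nhds x. (\<lambda>z. ?u z t) field_differentiable (at y)"
    using ux by eventually_elim (auto simp: field_differentiable_def)
  ultimately show ?thesis
    using ut uxx unfolding solves_BS_at_def by (auto simp: field_differentiable_def)
qed

theorem mainTheorem2:
  fixes \<alpha> \<beta> r \<sigma> \<A> :: real
    and f H R :: "real \<Rightarrow> real"
    and u :: "real \<Rightarrow> real \<Rightarrow> real"
    and \<Omega> :: "(real \<times> real) set"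
  assumes "\<alpha> \<noteq> 0" and "\<sigma> \<noteq> 0" and "\<A> \<noteq> 0" and "\<bar>\<A>\<bar> \<noteq> 1"
    and f_def: "f = (\<lambda>\<zeta>. \<alpha> * (\<zeta> - \<beta>)\<^sup>2)"
    and u_def: "u = (\<lambda>x t. \<beta> - 12 * \<sigma>\<^sup>2 / (\<alpha> * (t * (\<sigma>\<^sup>2 - 2 * r) + 2 * ln \<bar>x\<bar>)\<^sup>2))"
    and Omega_def: "\<Omega> = {(x, t). x \<noteq> 0 \<and> \<alpha> * (t * (\<sigma>\<^sup>2 - 2 * r) + 2 * ln \<bar>x\<bar>)\<^sup>2 \<noteq> 0}"
    and H_def: "H = (\<lambda>t. \<A> * exp (1/2 * (2 * r - \<sigma>\<^sup>2) * t))"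
    and R_def: "R = (\<lambda>t. \<beta> - 3 * \<sigma>\<^sup>2 / (\<alpha> * (ln \<bar>\<A>\<bar>)\<^sup>2))"
  shows "solves_BS_on \<Omega> r \<sigma> f u \<and> barrier_condition \<Omega> u H R"
proof
  let ?w = "\<lambda>z. \<beta> - 12 * \<sigma>\<^sup>2 / (\<alpha> * z\<^sup>2)"
  let ?w' = "\<lambda>z. 24 * \<sigma>\<^sup>2 / (\<alpha> * z ^ 3)"
  have w': "(?w has_real_derivative ?w' z) (at z)" if "z \<noteq> 0" for z
    using that \<open>\<alpha> \<noteq> 0\<close>
    by (auto intro!: derivative_eq_intros simp: field_simps power2_eq_square power3_eq_cube)
  have w2: "(?w' has_real_derivative - 72 * \<sigma>\<^sup>2 / (\<alpha> * z ^ 4)) (at z)" if "z \<noteq> 0" for z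
    using that \<open>\<alpha> \<noteq> 0\<close>
    by (auto intro!: derivative_eq_intros simp: field_simps eval_nat_numeral)
  have ode: "2 * \<sigma>\<^sup>2 * (- 72 * \<sigma>\<^sup>2 / (\<alpha> * z ^ 4)) + f (?w z) = 0" if "z \<noteq> 0" for z
    using that \<open>\<alpha> \<noteq> 0\<close> by (simp add: f_def field_simps eval_nat_numeral)
  show "solves_BS_on \<Omega> r \<sigma> f u"
    unfolding solves_BS_on_def
  proof clarify
    fix x t assume "(x, t) \<in> \<Omega>"
    then have x: "x \<noteq> 0" and L: "t * (\<sigma>\<^sup>2 - 2 * r) + 2 * ln \<bar>x\<bar> \<noteq> 0" (is "?L \<noteq> 0")
      by (auto simp: Omega_def)
    have "\<forall>\<^sub>F z in nhds ?L. z \<noteq> 0"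
      using L by (rule t1_space_nhds)
    then have "\<forall>\<^sub>F z in nhds ?L. (?w has_real_derivative ?w' z) (at z)"
      by eventually_elim (rule w')
    then show "solves_BS_at r \<sigma> f u x t"
      unfolding u_def
      by (intro solves_BS_at_travelling_wave[where w = ?w and w' = ?w' and f = f
            and ?w2.0 = "- 72 * \<sigma>\<^sup>2 / (\<alpha> * ?L ^ 4)"] x w2[OF L] ode[OF L])
  qed

  have "ln \<bar>\<A>\<bar> \<noteq> 0"
    using \<open>\<A> \<noteq> 0\<close> \<open>\<bar>\<A>\<bar> \<noteq> 1\<close> by simp
  moreover have "t * (\<sigma>\<^sup>2 - 2 * r) + 2 * ln \<bar>H t\<bar> = 2 * ln \<bar>\<A>\<bar>" for t
    using \<open>\<A> \<noteq> 0\<close> by (simp add: H_def abs_mult ln_mult algebra_simps)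
  moreover have "H t \<noteq> 0" for t
    using \<open>\<A> \<noteq> 0\<close> by (simp add: H_def)
  ultimately show "barrier_condition \<Omega> u H R"
    using \<open>\<alpha> \<noteq> 0\<close>
    by (simp add: barrier_condition_def Omega_def u_def R_def power_mult_distrib)
qed

end
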